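(* Let $\{Z_t\}_{t\ge0}$ be a branching process with offspring generating function $f$ such that $f(1)=1$, $f'(1)=1$ and $f'''(1)<\infty$, and let $F_t(s)=\mathrm{E}(s^{Z_t})$. Put $m_2=f''(1)/2$ and $m_3=f'''(1)/6$. Then for $t\ge0$ and $s\in[0,1)$, $$t=\frac{F_t(s)-s}{m_2(1-s)(1-F_t(s))}-\frac{m_3}{m_2^2}\ln\frac{1-F_t(s)}{1-s}+\int_s^{F_t(s)}\psi_{1,1}(x)\,dx,$$ where $$\psi_{1,1}(x)=\frac{f_4^2(x)}{m_2^2f_3(x)}-\frac{f_5(x)}{m_2^2}$$ and, for $x\in[0,1)$, $$f_3(x)=\frac{f(x)-x}{(1-x)^2},\qquad f_4(x)=\frac{m_2-f_3(x)}{1-x},\qquad f_5(x)=\frac{m_3-f_4(x)}{1-x}.$$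
   Context: Branching process: $f(s)=\sum_{k\ge0}p_ks^k$ is a probability generating function with $p_1\ne1$. $\{Z_t\}_{t\ge0}$ is the continuous-time Markov branching process with $Z_0=1$: particles have independent exponential life lengths with parameter 1, and at death a particle is, independently of everything else, replaced by $k$ particles with probability $p_k$, $k\ge0$. *)

theory Defs
  imports "HOL-Probability.Probability"
begin

definition pgf :: "nat pmf \<Rightarrow> real \<Rightarrow> real" where
  "pgf p s = (\<Sum>k. pmf p k * s ^ k)"

text \<open>
  Potential particles carry Ulam--Harris labels: the root is \<open>[]\<close>, and the children of \<open>u\<close> are
  \<open>u @ [0], \<dots>, u @ [n - 1]\<close>, where \<open>n\<close> is the number of offspring of \<open>u\<close>.  Every label carries a
  life length and an offspring number, also those labels that are never born; all of these
  variables are jointly independent (the pairs are independent across labels, and the two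
  components of each pair are independent).
\<close>

locale particle_system = prob_space M
  for M :: "'a measure" +
  fixes p :: "nat pmf"
    and life :: "nat list \<Rightarrow> 'a \<Rightarrow> real"
    and offspring :: "nat list \<Rightarrow> 'a \<Rightarrow> nat"
  assumes life_exponential:
      "\<And>u. distributed M lborel (life u) (exponential_density 1)"
    and offspring_measurable: "\<And>u. offspring u \<in> M \<rightarrow>\<^sub>M count_space UNIV"
    and offspring_distr: "\<And>u. distr M (count_space UNIV) (offspring u) = measure_pmf p"
    and life_offspring_indep:
      "\<And>u. indep_var borel (life u) (count_space UNIV) (offspring u)"
    and particles_indep:
      "indep_vars (\<lambda>_. borel \<Otimes>\<^sub>M count_space UNIV) (\<lambda>u \<omega>. (life u \<omega>, offspring u \<omega>)) UNIV"

definition is_born :: "(nat list \<Rightarrow> 'a \<Rightarrow> nat) \<Rightarrow> 'a \<Rightarrow> nat list \<Rightarrow> bool" where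
  "is_born offspring \<omega> u \<longleftrightarrow> (\<forall>k<length u. u ! k < offspring (take k u) \<omega>)"

definition birth_time :: "(nat list \<Rightarrow> 'a \<Rightarrow> real) \<Rightarrow> 'a \<Rightarrow> nat list \<Rightarrow> real" where
  "birth_time life \<omega> u = (\<Sum>k<length u. life (take k u) \<omega>)"

definition alive ::
  "(nat list \<Rightarrow> 'a \<Rightarrow> real) \<Rightarrow> (nat list \<Rightarrow> 'a \<Rightarrow> nat) \<Rightarrow> real \<Rightarrow> 'a \<Rightarrow> nat list set" where
  "alive life offspring t \<omega> =
     {u. is_born offspring \<omega> u \<and> birth_time life \<omega> u \<le> t \<and> t < birth_time life \<omega> u + life u \<omega>}"

text \<open>The process \<open>Z\<^sub>t\<close>; the value \<open>\<infinity>\<close> accounts for a possible explosion.\<close>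

definition population ::
  "(nat list \<Rightarrow> 'a \<Rightarrow> real) \<Rightarrow> (nat list \<Rightarrow> 'a \<Rightarrow> nat) \<Rightarrow> real \<Rightarrow> 'a \<Rightarrow> enat" where
  "population life offspring t \<omega> =
     (if finite (alive life offspring t \<omega>) then enat (card (alive life offspring t \<omega>)) else \<infinity>)"

text \<open>\<open>s\<^sup>n\<close> for an extended natural number \<open>n\<close>, with \<open>s\<^sup>\<infinity> = 0\<close>, as is right for \<open>0 \<le> s < 1\<close>.\<close>

definition epower :: "real \<Rightarrow> enat \<Rightarrow> real" where
  "epower s n = (case n of enat k \<Rightarrow> s ^ k | \<infinity> \<Rightarrow> 0)"

definition population_pgf ::
  "'a measure \<Rightarrow> (nat list \<Rightarrow> 'a \<Rightarrow> real) \<Rightarrow> (nat list \<Rightarrow> 'a \<Rightarrow> nat) \<Rightarrow> real \<Rightarrow> real \<Rightarrow> real" where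
  "population_pgf M life offspring t s =
     (\<integral>\<omega>. epower s (population life offspring t \<omega>) \<partial>M)"

definition f3 :: "(real \<Rightarrow> real) \<Rightarrow> real \<Rightarrow> real" where
  "f3 f x = (f x - x) / (1 - x)\<^sup>2"

definition f4 :: "(real \<Rightarrow> real) \<Rightarrow> real \<Rightarrow> real \<Rightarrow> real" where
  "f4 f m2 x = (m2 - f3 f x) / (1 - x)"

definition f5 :: "(real \<Rightarrow> real) \<Rightarrow> real \<Rightarrow> real \<Rightarrow> real \<Rightarrow> real" where
  "f5 f m2 m3 x = (m3 - f4 f m2 x) / (1 - x)"

definition psi11 :: "(real \<Rightarrow> real) \<Rightarrow> real \<Rightarrow> real \<Rightarrow> real \<Rightarrow> real" where
  "psi11 f m2 m3 x = (f4 f m2 x)\<^sup>2 / (m2\<^sup>2 * f3 f x) - f5 f m2 m3 x / m2\<^sup>2"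

end

theory Submission
  imports Defs
begin

text \<open>
  Split the family tree at the first death.  The subtrees of the children of the root are
  independent copies of the whole system, so \<open>F\<close> satisfies the renewal equation
  \<open>F\<^sub>t(s) = s e\<^sup>-\<^sup>t + \<integral>\<^sub>0\<^sup>t e\<^sup>-\<^sup>l f(F\<^sub>t\<^sub>-\<^sub>l(s)) dl\<close>; since infinitely many particles contribute
  \<open>s\<^sup>\<infinity> = 0\<close>, explosion need not be excluded.  Hence \<open>F\<close> is continuous in \<open>t\<close>, solves
  \<open>F' = f(F) - F\<close>, and stays below \<open>1\<close>.  As the critical generating function satisfies
  \<open>f(x) \<ge> x + p\<^sub>k (1 - x)\<^sup>2\<close> for every \<open>k \<ge> 2\<close>, we have \<open>f(x) > x\<close> on \<open>[0, 1)\<close> and \<open>m\<^sub>2 > 0\<close>.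
  The right-hand side of the theorem is the antiderivative of
  \<open>1 / (f(x) - x)\<close> taken from \<open>s\<close> to \<open>F\<^sub>t(s)\<close>, so its derivative in \<open>t\<close> is \<open>1\<close>.
\<close>

subsection \<open>The family tree as a function of its marks\<close>

abbreviation mark_space :: "(nat list \<Rightarrow> real \<times> nat) measure" where
  "mark_space \<equiv> PiM UNIV (\<lambda>_. borel \<Otimes>\<^sub>M count_space UNIV)"

abbreviation tree_alive :: "real \<Rightarrow> (nat list \<Rightarrow> real \<times> nat) \<Rightarrow> nat list set" where
  "tree_alive \<equiv> alive (\<lambda>u x. fst (x u)) (\<lambda>u x. snd (x u))"

abbreviation tree_population :: "real \<Rightarrow> (nat list \<Rightarrow> real \<times> nat) \<Rightarrow> enat" where
  "tree_population \<equiv> population (\<lambda>u x. fst (x u)) (\<lambda>u x. snd (x u))"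

text \<open>The outcome enters only through the marks, so the law of the population can be computed
  on the product space \<open>mark_space\<close>.\<close>

lemma population_eq_tree_population:
  "population life offspring t \<omega> = tree_population t (\<lambda>u. (life u \<omega>, offspring u \<omega>))"
  by (simp add: population_def alive_def is_born_def birth_time_def)

lemma pred_mem_tree_alive:
  "Measurable.pred (borel \<Otimes>\<^sub>M mark_space) (\<lambda>(t, x). u \<in> tree_alive t x)"
proof -
  have [measurable]: "(\<lambda>z. snd z v) \<in> borel \<Otimes>\<^sub>M mark_space \<rightarrow>\<^sub>M borel \<Otimes>\<^sub>M count_space UNIV" for v
    by measurable
  have [measurable]: "(\<lambda>z. fst (snd z v)) \<in> borel_measurable (borel \<Otimes>\<^sub>M mark_space)" for v
    by (rule measurable_compose[OF _ measurable_fst]) measurable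
  have offspring [measurable]: "(\<lambda>z. snd (snd z v)) \<in> borel \<Otimes>\<^sub>M mark_space \<rightarrow>\<^sub>M count_space UNIV" for v
    by (rule measurable_compose[OF _ measurable_snd]) measurable
  have [measurable]: "Measurable.pred (borel \<Otimes>\<^sub>M mark_space) (\<lambda>z. n < snd (snd z v))" for n v
    by (rule measurable_compose[OF offspring]) simp
  have [measurable]: "(\<lambda>z. fst z) \<in> borel_measurable (borel \<Otimes>\<^sub>M mark_space)"
    by (rule measurable_fst)
  have [measurable]:
    "Measurable.pred (borel \<Otimes>\<^sub>M mark_space) (\<lambda>z. is_born (\<lambda>u x. snd (x u)) (snd z) u)"
    unfolding is_born_def by measurable
  have [measurable]:
    "(\<lambda>z. birth_time (\<lambda>u x. fst (x u)) (snd z) u) \<in> borel_measurable (borel \<Otimes>\<^sub>M mark_space)"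
    unfolding birth_time_def by measurable
  show ?thesis
    unfolding alive_def case_prod_beta mem_Collect_eq by measurable
qed

text \<open>Measurability must be joint in time and marks, because subtrees are observed at the
  random time left after the root's death.\<close>

lemma measurable_tree_population [measurable]:
  "(\<lambda>(t, x). tree_population t x) \<in> borel \<Otimes>\<^sub>M mark_space \<rightarrow>\<^sub>M count_space UNIV"
proof -
  \<comment> \<open>The injection \<open>to_nat\<close> gives access to the measurability rules for
    finiteness and cardinality of random sets of naturals.\<close>
  let ?A = "\<lambda>z. to_nat ` tree_alive (fst z) (snd z)"
  have [measurable]: "Measurable.pred (borel \<Otimes>\<^sub>M mark_space) (\<lambda>z. u \<in> tree_alive (fst z) (snd z))" for u
    using pred_mem_tree_alive[of u] by (simp add: case_prod_beta)
  have [measurable]: "Measurable.pred (borel \<Otimes>\<^sub>M mark_space) (\<lambda>z. i \<in> ?A z)" for i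
    unfolding image_iff Bex_def by measurable
  have "(\<lambda>z. if finite (?A z) then enat (card (?A z)) else \<infinity>)
      \<in> borel \<Otimes>\<^sub>M mark_space \<rightarrow>\<^sub>M count_space UNIV"
    by measurable
  moreover have "finite (?A z) = finite (tree_alive (fst z) (snd z))"
    "card (?A z) = card (tree_alive (fst z) (snd z))" for z
    by (auto simp: finite_image_iff intro: card_image)
  ultimately show ?thesis
    unfolding population_def case_prod_beta by (simp cong: if_cong)
qed

section \<open>Extended cardinalities and powers with a possibly infinite exponent\<close>

lemma epower_0 [simp]: "epower s 0 = 1"
  by (simp add: epower_def zero_enat_def)

lemma epower_1 [simp]: "epower s 1 = s"
  by (simp add: epower_def one_enat_def)

text \<open>An infinite argument makes both sides 0, so exploding subtrees need no separate
  treatment later.\<close>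

lemma epower_add: "epower s (m + n) = epower s m * epower s n"
  by (cases m; cases n) (simp_all add: epower_def power_add)

lemma epower_sum: "finite A \<Longrightarrow> epower s (\<Sum>i\<in>A. n i) = (\<Prod>i\<in>A. epower s (n i))"
  by (induction A rule: finite_induct) (simp_all add: epower_add)

lemma epower_bounds:
  assumes "0 \<le> s" "s \<le> 1"
  shows "0 \<le> epower s n" "epower s n \<le> 1"
  using assms by (auto simp: epower_def power_le_one split: enat.split)

text \<open>Sending every infinite set to infinity makes counting additive over disjoint unions
  whether or not the sets are finite.\<close>

definition ecard :: "'a set \<Rightarrow> enat" where
  "ecard A = (if finite A then enat (card A) else \<infinity>)"

lemma ecard_image: "inj_on f A \<Longrightarrow> ecard (f ` A) = ecard A"
  by (simp add: ecard_def finite_image_iff card_image)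

lemma ecard_Un_disjoint: "A \<inter> B = {} \<Longrightarrow> ecard (A \<union> B) = ecard A + ecard B"
  by (simp add: ecard_def card_Un_disjoint)

lemma ecard_UN_disjoint:
  assumes "finite I" "disjoint_family_on A I"
  shows "ecard (\<Union>i\<in>I. A i) = (\<Sum>i\<in>I. ecard (A i))"
  using assms
proof (induction I rule: finite_induct)
  case empty
  then show ?case by (simp add: ecard_def zero_enat_def)
next
  case (insert i I)
  have "A i \<inter> (\<Union>j\<in>I. A j) = {}"
    using insert.prems insert.hyps by (auto simp: disjoint_family_on_def)
  then have "ecard (A i \<union> (\<Union>j\<in>I. A j)) = ecard (A i) + ecard (\<Union>j\<in>I. A j)"
    by (rule ecard_Un_disjoint)
  moreover have "disjoint_family_on A I"
    using insert.prems by (auto simp: disjoint_family_on_def)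
  ultimately show ?case
    using insert by simp
qed

lemma population_eq_ecard: "population life offspring t \<omega> = ecard (alive life offspring t \<omega>)"
  by (simp add: population_def ecard_def)

section \<open>Decomposition of the tree at its root\<close>

lemma Nil_mem_alive: "[] \<in> alive life offspring t \<omega> \<longleftrightarrow> 0 \<le> t \<and> t < life [] \<omega>"
  by (simp add: alive_def is_born_def birth_time_def)

text \<open>Splitting off index 0 removes the root from the birth conditions and its life from the
  birth time; what remains are the conditions for \<open>u\<close> in the subtree of child
  \<open>i\<close>.\<close>

lemma Cons_mem_tree_alive:
  "i # u \<in> tree_alive t x \<longleftrightarrow>
     i < snd (x []) \<and> u \<in> tree_alive (t - fst (x [])) (\<lambda>v. x (i # v))"
  unfolding alive_def is_born_def birth_time_def mem_Collect_eq length_Cons sum.lessThan_Suc_shift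
    All_less_Suc2
  by (auto simp: algebra_simps)

text \<open>The time remaining after the root's death is negative here, while birth times inside a
  child's subtree are sums of nonnegative lives.\<close>

lemma tree_alive_before_first_death:
  assumes "\<And>u. 0 \<le> fst (x u)" "0 \<le> t" "t < fst (x [])"
  shows "tree_alive t x = {[]}"
proof -
  have "i # u \<notin> tree_alive t x" for i u
  proof
    assume "i # u \<in> tree_alive t x"
    then have "(\<Sum>k<length u. fst (x (i # take k u))) \<le> t - fst (x [])"
      unfolding Cons_mem_tree_alive by (simp add: alive_def birth_time_def)
    moreover have "0 \<le> (\<Sum>k<length u. fst (x (i # take k u)))"
      by (intro sum_nonneg assms)
    ultimately show False
      using assms by simp
  qed
  moreover have "[] \<in> tree_alive t x"
    using assms by (simp add: Nil_mem_alive)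
  ultimately have "u \<in> tree_alive t x \<longleftrightarrow> u = []" for u
    by (cases u) auto
  then show ?thesis by auto
qed

lemma tree_alive_after_first_death:
  assumes "fst (x []) \<le> t"
  shows "tree_alive t x
    = (\<Union>i<snd (x []). (#) i ` tree_alive (t - fst (x [])) (\<lambda>u. x (i # u)))" (is "_ = ?R")
proof (intro set_eqI)
  fix u show "u \<in> tree_alive t x \<longleftrightarrow> u \<in> ?R"
    using assms by (cases u) (auto simp: Nil_mem_alive Cons_mem_tree_alive)
qed

definition tree_epower :: "real \<Rightarrow> real \<Rightarrow> (nat list \<Rightarrow> real \<times> nat) \<Rightarrow> real" where
  "tree_epower s t x = epower s (tree_population t x)"

lemma measurable_tree_epower [measurable]:
  "(\<lambda>(t, x). tree_epower s t x) \<in> borel_measurable (borel \<Otimes>\<^sub>M mark_space)"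
  unfolding tree_epower_def by measurable

lemma tree_epower_bounds:
  assumes "0 \<le> s" "s \<le> 1"
  shows "0 \<le> tree_epower s t x" "tree_epower s t x \<le> 1"
  unfolding tree_epower_def by (rule epower_bounds[OF assms])+

text \<open>The child subtrees occupy disjoint sets of labels, so populations add and powers
  multiply. Integrating this pathwise recursion yields the renewal equation.\<close>

lemma tree_epower_branching:
  assumes "\<And>u. 0 \<le> fst (x u)" "0 \<le> t"
  shows "tree_epower s t x =
    (if t < fst (x []) then s
     else \<Prod>i<snd (x []). tree_epower s (t - fst (x [])) (\<lambda>u. x (i # u)))"
proof (cases "t < fst (x [])")
  case True
  then have "tree_population t x = 1"
    using tree_alive_before_first_death[OF assms] by (simp add: population_def one_enat_def)
  with True show ?thesis
    by (simp add: tree_epower_def)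
next
  case False
  have "tree_population t x = (\<Sum>i<snd (x []). tree_population (t - fst (x [])) (\<lambda>u. x (i # u)))"
    using False unfolding population_eq_ecard
    by (subst tree_alive_after_first_death, simp, subst ecard_UN_disjoint)
      (auto simp: disjoint_family_on_def ecard_image)
  then show ?thesis
    using False by (simp add: tree_epower_def epower_sum)
qed

subsection \<open>Probability generating functions\<close>

lemma integrable_pmf_power:
  fixes p :: "nat pmf" and x :: real
  shows "0 \<le> x \<Longrightarrow> x \<le> 1 \<Longrightarrow> integrable (measure_pmf p) (\<lambda>n. x ^ n)"
  by (rule measure_pmf.integrable_const_bound[where B=1]) (auto simp: power_le_one)

text \<open>Bounds on \<open>pgf\<close> follow from this form, which also produces
  \<open>pgf\<close> when the offspring number is integrated out.\<close>

lemma expectation_power_eq_pgf: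
  assumes "0 \<le> x" "x \<le> 1"
  shows "(\<integral>n. x ^ n \<partial>measure_pmf p) = pgf p x"
proof -
  have "(\<integral>n. x ^ n \<partial>measure_pmf p) = (\<integral>n. pmf p n * x ^ n \<partial>count_space UNIV)"
    by (simp add: measure_pmf_eq_density integral_density)
  also have "\<dots> = pgf p x"
    unfolding pgf_def using integrable_pmf_power[OF assms, of p]
    by (intro integral_count_space_nat) (simp add: measure_pmf_eq_density integrable_density)
  finally show ?thesis .
qed

lemma pgf_bounds:
  assumes "0 \<le> x" "x \<le> 1"
  shows "0 \<le> pgf p x" "pgf p x \<le> 1"
  using assms integrable_pmf_power[OF assms, of p]
  by (auto simp: expectation_power_eq_pgf[symmetric] power_le_one
      intro!: integral_nonneg_AE measure_pmf.integral_le_const)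

lemma measurable_pgf [measurable]: "pgf p \<in> borel_measurable borel"
  unfolding pgf_def[abs_def] by measurable

subsection \<open>The renewal equation and the Kolmogorov equation\<close>

lemma Times_Int_vimage: "(\<lambda>x. (X x, Y x)) -` (A \<times> B) = X -` A \<inter> Y -` B"
  by auto

text \<open>Rectangles determine the product of two finite measures. The factors may have different
  types, as needed for a life with an offspring number and for the root's mark with the family of
  subtrees.\<close>

lemma (in prob_space) distr_pair_eqI:
  assumes X [measurable]: "random_variable S X" and Y [measurable]: "random_variable T Y"
    and "\<And>A B. A \<in> sets S \<Longrightarrow> B \<in> sets T \<Longrightarrow> prob (X -` A \<inter> Y -` B \<inter> space M)
      = prob (X -` A \<inter> space M) * prob (Y -` B \<inter> space M)"
  shows "distr M S X \<Otimes>\<^sub>M distr M T Y = distr M (S \<Otimes>\<^sub>M T) (\<lambda>x. (X x, Y x))"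
proof (rule pair_measure_eqI)
  interpret X: prob_space "distr M S X" by (rule prob_space_distr) fact
  interpret Y: prob_space "distr M T Y" by (rule prob_space_distr) fact
  show "sigma_finite_measure (distr M S X)" "sigma_finite_measure (distr M T Y)" ..
  fix A B assume "A \<in> sets (distr M S X)" "B \<in> sets (distr M T Y)"
  with assms(3)[of A B]
  show "emeasure (distr M S X) A * emeasure (distr M T Y) B
      = emeasure (distr M (S \<Otimes>\<^sub>M T) (\<lambda>x. (X x, Y x))) (A \<times> B)"
    by (simp add: emeasure_distr emeasure_eq_measure ennreal_mult Times_Int_vimage)
qed simp

section \<open>Law of the marks and independence of the subtrees\<close>

context particle_system
begin

abbreviation mark_distr :: "(real \<times> nat) measure" where
  "mark_distr \<equiv> density lborel (exponential_density 1) \<Otimes>\<^sub>M measure_pmf p"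

definition marks :: "'a \<Rightarrow> nat list \<Rightarrow> real \<times> nat" where
  "marks \<omega> u = (life u \<omega>, offspring u \<omega>)"

lemma life_measurable [measurable]: "life u \<in> borel_measurable M"
  using distributed_measurable[OF life_exponential] by simp

lemma offspring_measurable' [measurable]: "offspring u \<in> M \<rightarrow>\<^sub>M count_space UNIV"
  by (rule offspring_measurable)

lemma mark_measurable [measurable]: "(\<lambda>\<omega>. marks \<omega> u) \<in> M \<rightarrow>\<^sub>M borel \<Otimes>\<^sub>M count_space UNIV"
  unfolding marks_def by measurable

lemma marks_measurable [measurable]: "marks \<in> M \<rightarrow>\<^sub>M mark_space"
  using measurable_abs_UNIV[of "\<lambda>u \<omega>. marks \<omega> u", OF mark_measurable] by simp

lemma marks_indep: "indep_vars (\<lambda>_. borel \<Otimes>\<^sub>M count_space UNIV) (\<lambda>u \<omega>. marks \<omega> u) UNIV"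
  using particles_indep by (simp add: marks_def)

lemma distr_mark: "distr M (borel \<Otimes>\<^sub>M count_space UNIV) (\<lambda>\<omega>. marks \<omega> u) = mark_distr"
proof -
  have "density lborel (exponential_density 1) = distr M borel (life u)"
    using distributed_distr_eq_density[OF life_exponential[of u]]
    by (metis distr_cong sets_lborel)
  moreover have "distr M borel (life u) \<Otimes>\<^sub>M distr M (count_space UNIV) (offspring u)
      = distr M (borel \<Otimes>\<^sub>M count_space UNIV) (\<lambda>\<omega>. (life u \<omega>, offspring u \<omega>))"
  proof (rule distr_pair_eqI)
    fix A :: "real set" and B :: "nat set"
    assume A: "A \<in> sets borel"
    \<comment> \<open>\<open>indep_var\<close> wants both variables in one type, so the locale assumption is about \<open>real \<circ> offspring u\<close>.\<close>
    have "(\<lambda>\<omega>. real (offspring u \<omega>)) -` (real ` B) = offspring u -` B"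
      by auto
    then show "prob (life u -` A \<inter> offspring u -` B \<inter> space M)
        = prob (life u -` A \<inter> space M) * prob (offspring u -` B \<inter> space M)"
      using indep_varD[OF life_offspring_indep[of u] A, of "real ` B"]
      by (simp add: vimage_Int[symmetric] Times_Int_vimage)
  qed measurable
  ultimately show ?thesis
    by (simp add: marks_def offspring_distr)
qed

text \<open>Independence and a common marginal make the marks an i.i.d. family, whose law is stable
  under injective relabelling.\<close>

lemma distr_marks: "distr M mark_space marks = PiM UNIV (\<lambda>_. mark_distr)"
  using marks_indep by (subst (asm) indep_vars_iff_distr_eq_PiM) (auto simp: distr_mark restrict_UNIV)

lemma prob_space_mark_distr: "prob_space mark_distr"
  using prob_space_distr[OF mark_measurable, of "[]"] by (simp add: distr_mark)

lemma measurable_subtree [measurable]: "(\<lambda>\<omega> u. marks \<omega> (i # u)) \<in> M \<rightarrow>\<^sub>M mark_space"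
  by (intro measurable_abs_UNIV) measurable

text \<open>The relabelling \<open>u\<close> to \<open>i # u\<close> is injective, so reading an
  i.i.d. family along it reproduces the same product measure.\<close>

lemma distr_marks_subtree:
  "distr M mark_space (\<lambda>\<omega> u. marks \<omega> (i # u)) = distr M mark_space marks"
proof -
  have "distr M mark_space (\<lambda>\<omega> u. marks \<omega> (i # u))
      = distr (distr M mark_space marks) mark_space (\<lambda>z u. z (i # u))"
    by (subst distr_distr) (auto simp: comp_def intro!: measurable_abs_UNIV)
  also have "\<dots> = distr (PiM UNIV (\<lambda>_. mark_distr)) (PiM UNIV (\<lambda>_. mark_distr)) (\<lambda>z. \<lambda>u\<in>UNIV. z (i # u))"
    unfolding distr_marks by (rule distr_cong) (auto intro!: sets_PiM_cong sets_pair_measure_cong)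
  also have "\<dots> = PiM UNIV (\<lambda>_. mark_distr)"
    by (rule distr_PiM_reindex) (auto intro: prob_space_mark_distr)
  finally show ?thesis
    by (simp add: distr_marks)
qed

text \<open>Labels beginning with different \<open>i\<close> form disjoint blocks, and functions of
  disjoint blocks of independent marks are independent.\<close>

lemma subtrees_indep: "indep_vars (\<lambda>_. mark_space) (\<lambda>i \<omega> u. marks \<omega> (i # u)) UNIV"
proof -
  have "indep_vars (\<lambda>i. PiM (range ((#) i)) (\<lambda>_. borel \<Otimes>\<^sub>M count_space UNIV))
      (\<lambda>i \<omega>. restrict (marks \<omega>) (range ((#) i))) UNIV"
    by (rule indep_vars_restrict[OF marks_indep]) (auto simp: disjoint_family_on_def)
  then have "indep_vars (\<lambda>_. mark_space)
      (\<lambda>i \<omega>. (\<lambda>z u. z (i # u)) (restrict (marks \<omega>) (range ((#) i)))) UNIV"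
    by (rule indep_vars_compose2) (rule measurable_abs_UNIV, auto)
  then show ?thesis
    by simp
qed

lemma measurable_subtrees [measurable]:
  "(\<lambda>\<omega> i u. marks \<omega> (i # u)) \<in> M \<rightarrow>\<^sub>M PiM UNIV (\<lambda>_. mark_space)"
  by (intro measurable_abs_UNIV) measurable

text \<open>The root's mark and all subtrees depend on the complementary label blocks
  \<open>{[]}\<close> and \<open>- {[]}\<close>.\<close>

lemma distr_root_subtrees:
  "distr M ((borel \<Otimes>\<^sub>M count_space UNIV) \<Otimes>\<^sub>M PiM UNIV (\<lambda>_. mark_space))
      (\<lambda>\<omega>. (marks \<omega> [], \<lambda>i u. marks \<omega> (i # u)))
    = mark_distr \<Otimes>\<^sub>M distr M (PiM UNIV (\<lambda>_. mark_space)) (\<lambda>\<omega> i u. marks \<omega> (i # u))"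
proof -
  let ?N = "\<lambda>_. borel \<Otimes>\<^sub>M count_space UNIV :: (real \<times> nat) measure"
  let ?T = "PiM UNIV (\<lambda>_. mark_space) :: (nat \<Rightarrow> nat list \<Rightarrow> real \<times> nat) measure"
  have indep: "indep_var (PiM {[]} ?N) (\<lambda>\<omega>. restrict (marks \<omega>) {[]})
      (PiM (- {[]}) ?N) (\<lambda>\<omega>. restrict (marks \<omega>) (- {[]}))"
    by (rule indep_var_restrict[OF marks_indep]) auto
  have f [measurable]: "(\<lambda>z. z []) \<in> PiM {[]} ?N \<rightarrow>\<^sub>M ?N ()"
    by measurable
  have g [measurable]: "(\<lambda>z i u. z (i # u)) \<in> PiM (- {[]}) ?N \<rightarrow>\<^sub>M ?T"
    by (intro measurable_abs_UNIV) auto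
  have "distr M (?N ()) (\<lambda>\<omega>. marks \<omega> []) \<Otimes>\<^sub>M distr M ?T (\<lambda>\<omega> i u. marks \<omega> (i # u))
      = distr M (?N () \<Otimes>\<^sub>M ?T) (\<lambda>\<omega>. (marks \<omega> [], \<lambda>i u. marks \<omega> (i # u)))"
  proof (rule distr_pair_eqI)
    fix A :: "(real \<times> nat) set" and B :: "(nat \<Rightarrow> nat list \<Rightarrow> real \<times> nat) set"
    assume A: "A \<in> sets (?N ())" and B: "B \<in> sets ?T"
    \<comment> \<open>Both events are pulled back to the restricted families of marks, where block
      independence is available.\<close>
    let ?A = "(\<lambda>z. z []) -` A \<inter> space (PiM {[]} ?N)"
    let ?B = "(\<lambda>z i u. z (i # u)) -` B \<inter> space (PiM (- {[]}) ?N)"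
    have "(\<lambda>\<omega>. restrict (marks \<omega>) {[]}) -` ?A = (\<lambda>\<omega>. marks \<omega> []) -` A"
      "(\<lambda>\<omega>. restrict (marks \<omega>) (- {[]})) -` ?B = (\<lambda>\<omega> i u. marks \<omega> (i # u)) -` B"
      by (auto simp: space_PiM space_pair_measure)
    then show "prob ((\<lambda>\<omega>. marks \<omega> []) -` A \<inter> (\<lambda>\<omega> i u. marks \<omega> (i # u)) -` B \<inter> space M)
        = prob ((\<lambda>\<omega>. marks \<omega> []) -` A \<inter> space M)
          * prob ((\<lambda>\<omega> i u. marks \<omega> (i # u)) -` B \<inter> space M)"
      using indep_varD[OF indep measurable_sets[OF f A] measurable_sets[OF g B]]
      by (simp only: Times_Int_vimage)
  qed measurable
  then show ?thesis
    by (simp add: distr_mark)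
qed

text \<open>There are only countably many labels, and each life is negative with probability
  0.\<close>

lemma AE_life_nonneg: "AE \<omega> in M. \<forall>u. 0 \<le> life u \<omega>"
  unfolding AE_all_countable
  by (subst distributed_AE2[OF life_exponential]) (auto simp: exponential_density_def)

section \<open>Renewal equation for \<open>F\<close>\<close>

abbreviation F :: "real \<Rightarrow> real \<Rightarrow> real" where
  "F \<equiv> population_pgf M life offspring"

lemma population_pgf_eq: "F t s = (\<integral>\<omega>. tree_epower s t (marks \<omega>) \<partial>M)"
  by (simp add: population_pgf_def tree_epower_def population_eq_tree_population[of life]
      marks_def[abs_def])

lemma expectation_tree_epower_subtree:
  "(\<integral>\<omega>. tree_epower s t (\<lambda>u. marks \<omega> (i # u)) \<partial>M) = F t s"
proof -
  have [measurable]: "tree_epower s t \<in> borel_measurable mark_space"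
    by measurable
  have "(\<integral>\<omega>. tree_epower s t (\<lambda>u. marks \<omega> (i # u)) \<partial>M)
      = (\<integral>x. tree_epower s t x \<partial>distr M mark_space (\<lambda>\<omega> u. marks \<omega> (i # u)))"
    by (subst integral_distr) auto
  also have "\<dots> = (\<integral>x. tree_epower s t x \<partial>distr M mark_space marks)"
    by (simp only: distr_marks_subtree)
  also have "\<dots> = F t s"
    by (subst integral_distr) (auto simp: population_pgf_eq)
  finally show ?thesis .
qed

text \<open>This is the only regularity in time known until the renewal equation provides
  continuity.\<close>

lemma measurable_population_pgf [measurable]: "(\<lambda>t. F t s) \<in> borel_measurable borel"
  unfolding population_pgf_eq by measurable

lemma population_pgf_bounds:
  assumes "0 \<le> s" "s \<le> 1"
  shows "0 \<le> F t s" "F t s \<le> 1"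
  unfolding population_pgf_eq using assms
  by (auto intro!: integral_nonneg_AE integral_le_const integrable_const_bound[where B=1]
      simp: tree_epower_bounds)

text \<open>By Fubini the root's mark can be frozen; the subtrees are then observed at a fixed time,
  where they are independent with common mean \<open>F (t - l) s\<close>, and the expected product
  is a power.\<close>

lemma population_pgf_first_death:
  assumes "0 \<le> s" "s \<le> 1" "0 \<le> t"
  shows "F t s = (\<integral>(l, n). (if t < l then s else F (t - l) s ^ n) \<partial>mark_distr)"
proof -
  \<comment> \<open>Root mark and subtrees become separate arguments, so that their product law
    applies.\<close>
  define g :: "real \<times> nat \<Rightarrow> (nat \<Rightarrow> nat list \<Rightarrow> real \<times> nat) \<Rightarrow> real"
    where "g = (\<lambda>m y. if t < fst m then s else \<Prod>i<snd m. tree_epower s (t - fst m) (y i))"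
  let ?K = "borel \<Otimes>\<^sub>M count_space UNIV :: (real \<times> nat) measure"
  let ?T = "PiM UNIV (\<lambda>_. mark_space) :: (nat \<Rightarrow> nat list \<Rightarrow> real \<times> nat) measure"
  let ?Y = "\<lambda>\<omega> i u. marks \<omega> (i # u)"
  have g_meas [measurable]: "(\<lambda>(m, y). g m y) \<in> borel_measurable (?K \<Otimes>\<^sub>M ?T)"
  proof -
    \<comment> \<open>The number of factors is random but takes countably many values, so
      measurability is checked for each fixed \<open>n\<close>.\<close>
    have "(\<lambda>z. \<Prod>i<n. tree_epower s (t - fst (fst z)) (snd z i)) \<in> borel_measurable (?K \<Otimes>\<^sub>M ?T)" for n
      by measurable
    then have "(\<lambda>z. \<Prod>i<snd (fst z). tree_epower s (t - fst (fst z)) (snd z i))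
        \<in> borel_measurable (?K \<Otimes>\<^sub>M ?T)"
      by (rule measurable_compose_countable) measurable
    then show ?thesis
      unfolding g_def case_prod_beta by measurable
  qed
  have g_bound: "\<bar>g m y\<bar> \<le> 1" for m y
    using assms by (auto simp: g_def abs_prod intro!: prod_le_1 tree_epower_bounds
      simp: tree_epower_bounds)
  have Y_meas [measurable]: "?Y \<in> M \<rightarrow>\<^sub>M ?T"
    by measurable
  interpret K: prob_space mark_distr
    by (rule prob_space_mark_distr)
  interpret Y: prob_space "distr M ?T ?Y"
    by (rule prob_space_distr) measurable
  interpret KY: pair_prob_space mark_distr "distr M ?T ?Y" ..
  have inner: "(\<integral>\<omega>. g m (?Y \<omega>) \<partial>M) = (if t < fst m then s else F (t - fst m) s ^ snd m)" for m
  proof -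
    have "indep_vars (\<lambda>_. mark_space) (\<lambda>i \<omega> u. marks \<omega> (i # u)) {..<n}" for n :: nat
      by (rule indep_vars_subset[OF subtrees_indep]) simp
    then have "indep_vars (\<lambda>_. borel) (\<lambda>i \<omega>. tree_epower s v (?Y \<omega> i)) {..<n}" for v and n :: nat
      by (rule indep_vars_compose2) measurable
    moreover have "integrable M (\<lambda>\<omega>. tree_epower s v (?Y \<omega> i))" for v i
      by (rule integrable_const_bound[where B=1]) (auto simp: tree_epower_bounds assms)
    ultimately have "(\<integral>\<omega>. (\<Prod>i<n. tree_epower s v (?Y \<omega> i)) \<partial>M) = F v s ^ n" for v n
      by (subst indep_vars_lebesgue_integral) (auto simp: expectation_tree_epower_subtree)
    then show ?thesis
      by (simp add: g_def prob_space)
  qed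
  have "F t s = (\<integral>\<omega>. g (marks \<omega> []) (?Y \<omega>) \<partial>M)"
    unfolding population_pgf_eq
  proof (rule integral_cong_AE)
    \<comment> \<open>The pathwise recursion assumes nonnegative lives, hence equality almost
      surely.\<close>
    show "AE \<omega> in M. tree_epower s t (marks \<omega>) = g (marks \<omega> []) (?Y \<omega>)"
      using AE_life_nonneg
    proof eventually_elim
      case (elim \<omega>)
      then show ?case
        unfolding g_def using assms by (intro tree_epower_branching) (auto simp: marks_def)
    qed
  qed measurable
  also have "\<dots> = (\<integral>z. case_prod g z \<partial>distr M (?K \<Otimes>\<^sub>M ?T) (\<lambda>\<omega>. (marks \<omega> [], ?Y \<omega>)))"
    by (subst integral_distr) auto
  also have "distr M (?K \<Otimes>\<^sub>M ?T) (\<lambda>\<omega>. (marks \<omega> [], ?Y \<omega>)) = mark_distr \<Otimes>\<^sub>M distr M ?T ?Y"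
    by (rule distr_root_subtrees)
  also have "(\<integral>z. case_prod g z \<partial>(mark_distr \<Otimes>\<^sub>M distr M ?T ?Y))
      = (\<integral>m. (\<integral>y. g m y \<partial>distr M ?T ?Y) \<partial>mark_distr)"
    by (rule KY.integral_fst[symmetric], rule KY.integrable_const_bound[where B=1])
      (use g_bound in auto)
  also have "\<dots> = (\<integral>m. (\<integral>\<omega>. g m (?Y \<omega>) \<partial>M) \<partial>mark_distr)"
    by (intro Bochner_Integration.integral_cong refl integral_distr) auto
  also have "\<dots> = (\<integral>m. (if t < fst m then s else F (t - fst m) s ^ snd m) \<partial>mark_distr)"
    by (simp only: inner)
  also have "\<dots> = (\<integral>(l, n). (if t < l then s else F (t - l) s ^ n) \<partial>mark_distr)"
    by (intro Bochner_Integration.integral_cong refl) (simp add: case_prod_beta)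
  finally show ?thesis .
qed

text \<open>Integrating out the offspring number turns the power into \<open>pgf\<close>; the event
  that the root outlives \<open>t\<close> has probability \<open>exp (- t)\<close>.\<close>

lemma population_pgf_renewal:
  assumes s: "0 \<le> s" "s \<le> 1" and t: "0 \<le> t"
  shows "F t s = s * exp (- t)
    + (\<integral>l. exponential_density 1 l * (if t < l then 0 else pgf p (F (t - l) s)) \<partial>lborel)"
proof -
  let ?D = "density lborel (exponential_density 1)"
  let ?q = "\<lambda>l. if t < l then 0 else pgf p (F (t - l) s)"
  interpret D: prob_space ?D
    by (rule prob_space_exponential_density) simp
  interpret DP: pair_prob_space ?D "measure_pmf p" ..
  have tail: "measure ?D {t<..} = exp (- t)"
  proof -
    have "measure ?D {t<..} = measure (distr M lborel (life [])) {t<..}"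
      using distributed_distr_eq_density[OF life_exponential[of "[]"]] by simp
    also have "\<dots> = prob {\<omega>\<in>space M. t < life [] \<omega>}"
      by (subst measure_distr) (auto intro!: arg_cong[where f=prob])
    finally show ?thesis
      using exponential_distributedD_gt[OF life_exponential[of "[]"] t] by simp
  qed
  have "F t s = (\<integral>(l, n). (if t < l then s else F (t - l) s ^ n) \<partial>mark_distr)"
    by (rule population_pgf_first_death[OF assms])
  also have "\<dots> = (\<integral>l. (\<integral>n. (if t < l then s else F (t - l) s ^ n) \<partial>measure_pmf p) \<partial>?D)"
  proof (rule DP.integral_fst[symmetric], rule DP.integrable_const_bound[where B=1])
    show "(\<lambda>(l, n). if t < l then s else F (t - l) s ^ n) \<in> borel_measurable mark_distr"
      by measurable
  qed (use s population_pgf_bounds[OF s] in \<open>auto simp: power_le_one\<close>)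
  also have "\<dots> = (\<integral>l. s * indicator {t<..} l + ?q l \<partial>?D)"
    by (intro Bochner_Integration.integral_cong)
      (auto simp: expectation_power_eq_pgf population_pgf_bounds[OF s])
  also have "\<dots> = (\<integral>l. s * indicator {t<..} l \<partial>?D) + (\<integral>l. ?q l \<partial>?D)"
  proof (rule Bochner_Integration.integral_add)
    show "integrable ?D ?q"
      by (rule D.integrable_const_bound[where B=1])
        (auto simp: pgf_bounds population_pgf_bounds[OF s])
    show "integrable ?D (\<lambda>l. s * indicator {t<..} l)"
      by (rule D.integrable_const_bound[where B=1]) (auto simp: s indicator_def)
  qed
  also have "(\<integral>l. s * indicator {t<..} l \<partial>?D) = s * exp (- t)"
    using tail by simp
  also have "(\<integral>l. ?q l \<partial>?D) = (\<integral>l. exponential_density 1 l * ?q l \<partial>lborel)"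
    by (subst integral_real_density) (auto simp: exponential_density_def)
  finally show ?thesis .
qed

section \<open>From the renewal equation to the differential equation in time\<close>

lemma set_integrable_exp_pgf:
  assumes s: "0 \<le> s" "s \<le> 1"
  shows "set_integrable lborel {0..t} (\<lambda>v. exp v * pgf p (F v s))"
  unfolding set_integrable_def
proof (rule Bochner_Integration.integrable_bound)
  show "integrable lborel (\<lambda>v. indicator {0..t} v *\<^sub>R exp v)"
    using borel_integrable_atLeastAtMost'[of 0 t exp]
    by (simp add: set_integrable_def continuous_on_exp)
  show "AE v in lborel. norm (indicator {0..t} v *\<^sub>R (exp v * pgf p (F v s)))
      \<le> norm (indicator {0..t} v *\<^sub>R exp v)"
    using pgf_bounds[OF population_pgf_bounds[OF s]]
    by (auto simp: indicator_def abs_mult intro!: mult_left_le)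
qed measurable

text \<open>Substituting \<open>v = t - l\<close> pulls \<open>exp (- t)\<close> out of the integral
  and leaves \<open>t\<close> only as the upper limit.\<close>

lemma population_pgf_integral_equation:
  assumes s: "0 \<le> s" "s \<le> 1" and t: "0 \<le> t"
  shows "F t s = exp (- t) * (s + integral {0..t} (\<lambda>v. exp v * pgf p (F v s)))"
proof -
  let ?q = "\<lambda>l. exponential_density 1 l * (if t < l then 0 else pgf p (F (t - l) s))"
  have "(\<integral>l. ?q l \<partial>lborel) = (\<integral>v. ?q (t + (-1) * v) \<partial>lborel)"
    by (subst lborel_integral_real_affine[where c="-1" and t=t]) simp_all
  \<comment> \<open>The density vanishes for \<open>v > t\<close> and the cutoff for
    \<open>v < 0\<close>, which leaves the interval \<open>{0..t}\<close>.\<close>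
  also have "\<dots> = (\<integral>v. exp (- t) * (indicator {0..t} v *\<^sub>R (exp v * pgf p (F v s))) \<partial>lborel)"
    by (intro Bochner_Integration.integral_cong)
      (auto simp: exponential_density_def indicator_def exp_diff exp_minus field_simps)
  also have "\<dots> = exp (- t) * integral {0..t} (\<lambda>v. exp v * pgf p (F v s))"
    using set_borel_integral_eq_integral(2)[OF set_integrable_exp_pgf[OF s]]
    by (simp add: set_lebesgue_integral_def)
  finally show ?thesis
    using population_pgf_renewal[OF assms] by (simp add: algebra_simps)
qed

lemma population_pgf_0: "0 \<le> s \<Longrightarrow> s \<le> 1 \<Longrightarrow> F 0 s = s"
  by (subst population_pgf_integral_equation) auto

text \<open>Bounding \<open>pgf\<close> by 1 in the integral equation gives
  \<open>F t s <= 1 - exp (- t) * (1 - s)\<close>.\<close>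

lemma population_pgf_less_1:
  assumes "0 \<le> s" "s < 1" "0 \<le> t"
  shows "F t s < 1"
proof -
  have s: "s \<le> 1"
    using assms by simp
  have "(exp has_integral exp t - exp 0) {0..t}"
    by (rule fundamental_theorem_of_calculus)
      (use assms in \<open>auto intro!: derivative_eq_intros simp flip: has_real_derivative_iff_has_vector_derivative\<close>)
  then have exp_int: "integral {0..t} exp = exp t - 1" "exp integrable_on {0..t}"
    by (auto simp: integral_unique)
  have "integral {0..t} (\<lambda>v. exp v * pgf p (F v s)) \<le> integral {0..t} exp"
    using set_borel_integral_eq_integral(1)[OF set_integrable_exp_pgf[OF assms(1) s]] exp_int(2)
    by (rule integral_le)
      (use pgf_bounds[OF population_pgf_bounds[OF assms(1) s]] in \<open>auto intro!: mult_left_le\<close>)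
  then have "F t s \<le> exp (- t) * (s + (exp t - 1))"
    using exp_int(1) by (subst population_pgf_integral_equation[OF assms(1) s assms(3)]) simp
  also have "\<dots> < exp (- t) * exp t"
    using assms by (intro mult_strict_left_mono) auto
  also have "\<dots> = 1"
    by (simp flip: exp_add)
  finally show ?thesis .
qed

text \<open>Regularity is bootstrapped: integrability makes the right-hand side of the integral
  equation continuous, so \<open>F\<close> and then the integrand are continuous, so the right-hand
  side is differentiable.\<close>

lemma population_pgf_has_derivative:
  assumes f: "continuous_on {0..1} (pgf p)" and s: "0 \<le> s" "s \<le> 1" and v: "v \<in> {0..t}"
  shows "((\<lambda>t. F t s) has_real_derivative pgf p (F v s) - F v s) (at v within {0..t})"
proof -
  let ?g = "\<lambda>v. exp v * pgf p (F v s)"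
  let ?J = "\<lambda>x. exp (- x) * (s + integral {0..x} ?g)"
  have F_eq: "F x s = ?J x" if "x \<in> {0..t}" for x
    using that by (intro population_pgf_integral_equation s) auto
  have "continuous_on {0..t} ?J"
    using indefinite_integral_continuous_1[OF set_borel_integral_eq_integral(1)[OF set_integrable_exp_pgf[OF s]]]
    by (intro continuous_intros)
  then have "continuous_on {0..t} (\<lambda>x. F x s)"
    by (rule continuous_on_cong[THEN iffD1, OF refl, rotated]) (simp add: F_eq)
  then have "continuous_on {0..t} ?g"
    by (intro continuous_intros continuous_on_compose2[OF f])
      (auto simp: population_pgf_bounds[OF s])
  then have "((\<lambda>x. integral {0..x} ?g) has_real_derivative ?g v) (at v within {0..t})"
    by (rule integral_has_real_derivative) (rule v)
  then have "(?J has_real_derivative exp (- v) * ?g v - ?J v) (at v within {0..t})"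
    by (auto intro!: derivative_eq_intros simp: algebra_simps)
  moreover have "exp (- v) * ?g v - ?J v = pgf p (F v s) - F v s"
    by (simp add: F_eq[OF v] flip: mult.assoc exp_add)
  ultimately show ?thesis
    using has_field_derivative_transform_within[of ?J _ v "{0..t}" 1 "\<lambda>x. F x s"] v F_eq by simp
qed

end
subsection \<open>Critical generating functions\<close>

text \<open>A quadratic sharpening of Bernoulli's inequality, with equality at \<open>k = 2\<close>.
  The induction step gains \<open>(1 - x)^2 * (k - (1 - x))\<close>, which is nonnegative.\<close>

lemma power_ge_quadratic:
  fixes x :: real
  assumes "0 \<le> x" "x \<le> 1" "2 \<le> k"
  shows "1 - real k * (1 - x) + (1 - x)\<^sup>2 \<le> x ^ k"
  using \<open>2 \<le> k\<close>
proof (induction k rule: dec_induct)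
  case base
  show ?case by (simp add: power2_eq_square algebra_simps)
next
  case (step k)
  have "(1 - real k * (1 - x) + (1 - x)\<^sup>2) * x \<le> x ^ Suc k"
    using mult_right_mono[OF step.IH assms(1)] by (simp add: mult.commute)
  moreover have "1 - real (Suc k) * (1 - x) + (1 - x)\<^sup>2 \<le> (1 - real k * (1 - x) + (1 - x)\<^sup>2) * x"
  proof -
    have "(1 - real k * (1 - x) + (1 - x)\<^sup>2) * x - (1 - real (Suc k) * (1 - x) + (1 - x)\<^sup>2)
        = (1 - x)\<^sup>2 * (real k - (1 - x))"
      by (simp add: power2_eq_square algebra_simps)
    moreover have "0 \<le> (1 - x)\<^sup>2 * (real k - (1 - x))"
      using step.hyps assms by (intro mult_nonneg_nonneg) auto
    ultimately show ?thesis by linarith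
  qed
  ultimately show ?case by linarith
qed

lemma summable_pmf_power:
  fixes x :: real
  assumes "0 \<le> x" "x \<le> 1"
  shows "summable (\<lambda>k. pmf p k * x ^ k)"
proof (rule summable_comparison_test')
  show "summable (pmf p :: nat \<Rightarrow> real)"
    using integrable_pmf[of _ p] integrable_count_space_nat_iff[of "pmf p"] by simp
  show "norm (pmf p k * x ^ k) \<le> pmf p k" if "0 \<le> k" for k
    using assms by (simp add: abs_mult power_le_one mult_left_le)
qed

lemma summable_pmf: "summable (pmf p :: nat \<Rightarrow> real)"
  using summable_pmf_power[of 1 p] by simp

lemma suminf_pmf: "(\<Sum>k. pmf p k) = (1::real)" for p :: "nat pmf"
  using expectation_power_eq_pgf[of 1 p] by (simp add: pgf_def)

text \<open>Each difference quotient of \<open>pgf p\<close> at \<open>1\<close> dominates the corresponding partial sum.\<close>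

lemma sum_mean_le_deriv_pgf:
  assumes "(pgf p has_real_derivative d) (at 1 within {0..1})"
  shows "(\<Sum>k<n. pmf p k * real k) \<le> d"
proof (rule tendsto_le[of "at_left (1::real)"])
  have flip: "(a - b) / (c - d) = (b - a) / (d - c)" for a b c d :: real
    by (metis minus_diff_eq minus_divide_divide)
  have at: "at 1 within {0..1} = at_left (1::real)"
    by (rule at_within_Icc_at_left) simp
  show "((\<lambda>x. (pgf p x - pgf p 1) / (x - 1)) \<longlongrightarrow> d) (at_left 1)"
    using assms by (simp add: has_field_derivative_iff at)
  have "((\<lambda>x. \<Sum>k<n. pmf p k * ((x ^ k - 1 ^ k) / (x - 1)))
      \<longlongrightarrow> (\<Sum>k<n. pmf p k * (real k * 1 ^ (k - Suc 0)))) (at_left 1)"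
    using DERIV_pow[of _ "1::real" "{..<1}"]
    by (intro tendsto_intros) (simp add: has_field_derivative_iff)
  then show "((\<lambda>x. \<Sum>k<n. pmf p k * ((x ^ k - 1) / (x - 1)))
      \<longlongrightarrow> (\<Sum>k<n. pmf p k * real k)) (at_left 1)"
    by simp
  have "(\<Sum>k<n. pmf p k * ((x ^ k - 1) / (x - 1))) \<le> (pgf p x - pgf p 1) / (x - 1)"
    if x: "0 < x" "x < 1" for x :: real
  proof -
    have sums: "summable (\<lambda>k. pmf p k * x ^ k)" "summable (\<lambda>k. pmf p k)"
      using x by (auto intro!: summable_pmf_power summable_pmf)
    have eq: "(\<Sum>k. pmf p k * ((1 - x ^ k) / (1 - x))) = (pgf p x - pgf p 1) / (x - 1)"
      and sm: "summable (\<lambda>k. pmf p k * ((1 - x ^ k) / (1 - x)))"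
    proof -
      have "(\<lambda>k. (pmf p k - pmf p k * x ^ k) / (1 - x)) sums ((pgf p 1 - pgf p x) / (1 - x))"
        unfolding pgf_def using sums by (intro sums_divide sums_diff summable_sums) auto
      moreover have "(pgf p 1 - pgf p x) / (1 - x) = (pgf p x - pgf p 1) / (x - 1)"
        by (rule flip)
      ultimately have "(\<lambda>k. pmf p k * ((1 - x ^ k) / (1 - x))) sums ((pgf p x - pgf p 1) / (x - 1))"
        by (simp add: algebra_simps)
      then show "(\<Sum>k. pmf p k * ((1 - x ^ k) / (1 - x))) = (pgf p x - pgf p 1) / (x - 1)"
        "summable (\<lambda>k. pmf p k * ((1 - x ^ k) / (1 - x)))"
        by (auto simp: sums_iff)
    qed
    have "(\<Sum>k<n. pmf p k * ((x ^ k - 1) / (x - 1))) = (\<Sum>k<n. pmf p k * ((1 - x ^ k) / (1 - x)))"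
      by (simp only: flip[of _ 1 x])
    also have "\<dots> \<le> (\<Sum>k. pmf p k * ((1 - x ^ k) / (1 - x)))"
      using x by (intro sum_le_suminf sm) (auto simp: power_le_one)
    finally show ?thesis
      using eq by simp
  qed
  then show "\<forall>\<^sub>F x in at_left 1. (\<Sum>k<n. pmf p k * ((x ^ k - 1) / (x - 1)))
      \<le> (pgf p x - pgf p 1) / (x - 1)"
    by (auto simp: eventually_at_left[of 0] intro!: exI[of _ 0])
qed simp

text \<open>Bernoulli's inequality is summed over all terms, with the quadratic sharpening spent on
  the single index \<open>k\<close>. The mean enters with a negative sign, so its upper bound
  \<open>d\<close> suffices.\<close>

lemma pgf_ge_quadratic:
  assumes "(pgf p has_real_derivative d) (at 1 within {0..1})" "2 \<le> k" "0 \<le> x" "x \<le> 1"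
  shows "1 - d * (1 - x) + pmf p k * (1 - x)\<^sup>2 \<le> pgf p x"
proof -
  have mean: "summable (\<lambda>k. pmf p k * real k)"
    by (rule bounded_imp_summable[where B=d])
      (use sum_mean_le_deriv_pgf[OF assms(1), of "Suc _"] in \<open>auto simp: lessThan_Suc_atMost\<close>)
  have mean_le: "(\<Sum>k. pmf p k * real k) \<le> d"
    by (rule suminf_le_const[OF mean]) (rule sum_mean_le_deriv_pgf[OF assms(1)])
  let ?c = "\<lambda>j. if j = k then pmf p k * (1 - x)\<^sup>2 else 0"
  have c: "?c sums (pmf p k * (1 - x)\<^sup>2)"
    by (rule sums_single)
  have lower: "(\<lambda>j. pmf p j - pmf p j * real j * (1 - x) + ?c j)
      sums (1 - (\<Sum>k. pmf p k * real k) * (1 - x) + pmf p k * (1 - x)\<^sup>2)"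
    using summable_sums[OF summable_pmf, of p] summable_sums[OF mean]
    by (intro sums_add sums_diff sums_mult2 c) (simp_all add: suminf_pmf)
  have upper: "(\<lambda>j. pmf p j * x ^ j) sums pgf p x"
    unfolding pgf_def by (rule summable_sums) (rule summable_pmf_power[OF assms(3,4)])
  have "pmf p j - pmf p j * real j * (1 - x) + ?c j \<le> pmf p j * x ^ j" for j
  proof (cases "j = k")
    case True
    then show ?thesis
      using mult_left_mono[OF power_ge_quadratic[OF assms(3,4,2)], of "pmf p k"]
      by (simp add: algebra_simps)
  next
    case False
    have "1 - real j * (1 - x) \<le> x ^ j"
      using Bernoulli_inequality[of "x - 1" j] assms by (simp add: algebra_simps)
    then show ?thesis
      using False mult_left_mono[of "1 - real j * (1 - x)" "x ^ j" "pmf p j"]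
      by (simp add: algebra_simps)
  qed
  then have "1 - (\<Sum>k. pmf p k * real k) * (1 - x) + pmf p k * (1 - x)\<^sup>2 \<le> pgf p x"
    by (rule sums_le[OF _ lower upper])
  moreover have "(\<Sum>k. pmf p k * real k) * (1 - x) \<le> d * (1 - x)"
    using mean_le assms by (intro mult_right_mono) auto
  ultimately show ?thesis by linarith
qed

text \<open>Otherwise \<open>pgf p\<close> would be affine with slope \<open>pmf p 1\<close>,
  forcing \<open>pmf p 1 = 1\<close>.\<close>

lemma critical_offspring_ge_2:
  assumes "(pgf p has_real_derivative 1) (at 1 within {0..1})" "pmf p 1 \<noteq> 1"
  obtains k where "2 \<le> k" "0 < pmf p k"
proof -
  have "\<exists>k\<ge>2. 0 < pmf p k"
  proof (rule ccontr)
    assume "\<not> ?thesis"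
    then have zero: "pmf p k = 0" if "2 \<le> k" for k
      using that pmf_nonneg[of p k] by (auto simp: less_le)
    have "pgf p = (\<lambda>x. pmf p 0 + pmf p 1 * x)"
      unfolding pgf_def using zero
      by (intro ext, subst suminf_finite[of "{0, 1}"]) (auto simp: not_less_eq_eq numeral_2_eq_2)
    moreover have "((\<lambda>x. pmf p 0 + pmf p 1 * x) has_real_derivative pmf p 1) (at 1 within {0..1})"
      by (auto intro!: derivative_eq_intros)
    moreover have "at (1::real) within {0..1} \<noteq> bot"
      by (simp add: at_within_Icc_at_left)
    ultimately show False
      using assms has_field_derivative_unique by metis
  qed
  then show ?thesis
    using that by blast
qed

text \<open>If \<open>d < 0\<close>, then \<open>g'\<close> is positive just to the left of its zero
  at 1, so \<open>g\<close> increases strictly towards 1, contradicting the minimum there.\<close>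

lemma second_derivative_nonneg_of_min:
  fixes g :: "real \<Rightarrow> real"
  assumes g': "\<And>x. x \<in> {0..1} \<Longrightarrow> (g has_real_derivative g' x) (at x within {0..1})"
    and g'': "(g' has_real_derivative d) (at 1 within {0..1})"
    and "g' 1 = 0" "\<And>x. x \<in> {0..1} \<Longrightarrow> g 1 \<le> g x"
  shows "0 \<le> d"
proof (rule ccontr)
  assume "\<not> 0 \<le> d"
  then obtain e where e: "0 < e" "\<And>h. 0 < h \<Longrightarrow> 1 - h \<in> {0..1} \<Longrightarrow> h < e \<Longrightarrow> 0 < g' (1 - h)"
    using has_real_derivative_neg_dec_left[OF g''] \<open>g' 1 = 0\<close> by force
  \<comment> \<open>The halves keep \<open>a\<close> strictly inside the unit interval and within
    distance \<open>e\<close> of 1.\<close>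
  define a where "a = 1 - min (e / 2) (1 / 2)"
  have a: "0 < a" "a < 1" "1 - a < e"
    using e(1) by (auto simp: a_def min_def)
  have "(g has_derivative (\<lambda>h. g' x * h)) (at x within {a..1})" if "a \<le> x" "x \<le> 1" for x
    using DERIV_subset[OF g', of x "{a..1}"] that a by (simp add: has_field_derivative_def)
  then obtain x where x: "a < x" "x < 1" "g 1 - g a = g' x * (1 - a)"
    using mvt_simple[of a 1 g "\<lambda>x h. g' x * h"] a by auto
  have "0 < g' x"
    using e(2)[of "1 - x"] x a by simp
  then have "g a < g 1"
    using x a by (smt (verit) mult_pos_pos)
  then show False
    using assms(4)[of a] a by simp
qed

text \<open>By \<open>pgf_ge_quadratic\<close> the function
  \<open>pgf p x - x - pmf p k * (1 - x)^2\<close> is minimal at 1, where its first derivative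
  vanishes and its second is \<open>d - 2 * pmf p k\<close>.\<close>

lemma second_derivative_pgf_ge:
  assumes f': "\<And>x. x \<in> {0..1} \<Longrightarrow> (pgf p has_real_derivative f' x) (at x within {0..1})"
    and f'': "(f' has_real_derivative d) (at 1 within {0..1})"
    and "f' 1 = 1" "2 \<le> k"
  shows "2 * pmf p k \<le> d"
proof -
  let ?c = "pmf p k"
  have "0 \<le> d - 2 * ?c"
  proof (rule second_derivative_nonneg_of_min)
    show "((\<lambda>x. pgf p x - x - ?c * (1 - x)\<^sup>2) has_real_derivative f' x - 1 + 2 * ?c * (1 - x))
        (at x within {0..1})" if "x \<in> {0..1}" for x
      by (rule derivative_eq_intros f'[OF that] refl | simp add: algebra_simps)+
    show "((\<lambda>x. f' x - 1 + 2 * ?c * (1 - x)) has_real_derivative d - 2 * ?c) (at 1 within {0..1})"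
      by (rule derivative_eq_intros f'' refl | simp)+
    show "pgf p 1 - 1 - ?c * (1 - 1)\<^sup>2 \<le> pgf p x - x - ?c * (1 - x)\<^sup>2" if "x \<in> {0..1}" for x
      using pgf_ge_quadratic[OF f'[of 1] \<open>2 \<le> k\<close>, of x] that \<open>f' 1 = 1\<close> suminf_pmf[of p]
      by (simp add: pgf_def)
  qed (simp add: \<open>f' 1 = 1\<close>)
  then show ?thesis by simp
qed

subsection \<open>Integrating the differential equation\<close>

text \<open>Each of the definitions \<open>f4\<close>, \<open>f5\<close> peels one power of \<open>1 - x\<close> off the previous function:
  \<open>m2 = f3 + (1 - x) * f4\<close> and \<open>m3 = f4 + (1 - x) * f5\<close>.\<close>

lemma psi11_partial_fraction:
  assumes "x < 1" "x < f x" "0 < m2"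
  shows "1 / (m2 * (1 - x)\<^sup>2) + m3 / m2\<^sup>2 / (1 - x) + psi11 f m2 m3 x = 1 / (f x - x)"
proof -
  define d a c e where "d = 1 - x" and "a = f3 f x" and "c = f4 f m2 x" and "e = f5 f m2 m3 x"
  have pos: "0 < d" "0 < a"
    using assms by (auto simp: d_def a_def f3_def)
  have m2: "m2 = a + d * c" and m3: "m3 = c + d * e" and fx: "f x - x = d\<^sup>2 * a"
    using assms(1) by (auto simp: d_def a_def c_def e_def f3_def f4_def f5_def)
  have "1 / (m2 * d\<^sup>2) + m3 / m2\<^sup>2 / d + (c\<^sup>2 / (m2\<^sup>2 * a) - e / m2\<^sup>2)
      = (m2 * a + (m3 - d * e) * d * a + c\<^sup>2 * d\<^sup>2) / (m2\<^sup>2 * d\<^sup>2 * a)"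
    using pos assms(3) by (simp add: field_simps power2_eq_square)
  \<comment> \<open>Since \<open>m3 - d * e = c\<close> and \<open>m2 = a + d * c\<close>, the left
    side is the expanded square of \<open>a + d * c\<close>.\<close>
  also have "m2 * a + (m3 - d * e) * d * a + c\<^sup>2 * d\<^sup>2 = m2\<^sup>2"
    unfolding m2 m3 by (simp add: algebra_simps power2_eq_square)
  also have "m2\<^sup>2 / (m2\<^sup>2 * d\<^sup>2 * a) = 1 / (d\<^sup>2 * a)"
    using assms(3) by simp
  finally show ?thesis
    by (simp add: psi11_def fx flip: d_def a_def c_def e_def)
qed

lemma continuous_on_psi11:
  assumes f: "continuous_on A f" and A: "\<And>x. x \<in> A \<Longrightarrow> x < 1 \<and> x < f x" and "0 < m2"
  shows "continuous_on A (psi11 f m2 m3)"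
proof -
  have nz: "1 - x \<noteq> 0" "f3 f x \<noteq> 0" if "x \<in> A" for x
    using A[OF that] by (auto simp: f3_def)
  have f3: "continuous_on A (f3 f)"
    unfolding f3_def[abs_def] using nz by (intro continuous_intros f) auto
  have f4: "continuous_on A (f4 f m2)"
    unfolding f4_def[abs_def] using nz by (intro continuous_intros f3) auto
  have "continuous_on A (f5 f m2 m3)"
    unfolding f5_def[abs_def] using nz by (intro continuous_intros f4) auto
  then show ?thesis
    unfolding psi11_def[abs_def] using nz \<open>0 < m2\<close>
    by (intro continuous_intros f3 f4) auto
qed

lemma nonneg_derivative_imp_mono:
  fixes y :: "real \<Rightarrow> real"
  assumes y: "\<And>v. v \<in> {a..b} \<Longrightarrow> (y has_real_derivative y' v) (at v within {a..b})"
    and nonneg: "\<And>v. v \<in> {a..b} \<Longrightarrow> 0 \<le> y' v"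
    and uv: "a \<le> u" "u \<le> v" "v \<le> b"
  shows "y u \<le> y v"
proof (cases "u = v")
  case False
  have "(y has_derivative (\<lambda>h. y' x * h)) (at x within {u..v})" if "u \<le> x" "x \<le> v" for x
    using DERIV_subset[OF y, of x "{u..v}"] that uv by (simp add: has_field_derivative_def)
  then obtain x where "x \<in> {u<..<v}" "y v - y u = y' x * (v - u)"
    using mvt_simple[of u v y "\<lambda>x h. y' x * h"] False uv by auto
  then show ?thesis
    using nonneg[of x] uv by (smt (verit) greaterThanLessThan_iff atLeastAtMost_iff mult_nonneg_nonneg)
qed simp

text \<open>Separation of variables: for an antiderivative \<open>H\<close> of
  \<open>1 / (f x - x)\<close> the difference \<open>H (y v) - v\<close> is constant, and its values
  at \<open>0\<close> and \<open>t\<close> are compared.\<close>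

lemma autonomous_ode_integral_identity:
  assumes f: "continuous_on {0..1} f" and above: "\<And>x. x \<in> {0..<1} \<Longrightarrow> x < f x" and "0 < m2"
    and t: "0 \<le> t" and range: "\<And>v. v \<in> {0..t} \<Longrightarrow> y v \<in> {0..<1}"
    and y: "\<And>v. v \<in> {0..t} \<Longrightarrow> (y has_real_derivative f (y v) - y v) (at v within {0..t})"
  shows "t = (y t - y 0) / (m2 * (1 - y 0) * (1 - y t))
             - m3 / m2\<^sup>2 * ln ((1 - y t) / (1 - y 0))
             + (LBINT x=y 0..y t. psi11 f m2 m3 x)"
proof -
  \<comment> \<open>Monotonicity confines the solution to \<open>{y 0..y t}\<close>, a compact
    interval below 1 on which \<open>psi11\<close> is continuous.\<close>
  have mono: "y u \<le> y v" if "0 \<le> u" "u \<le> v" "v \<le> t" for u v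
    by (rule nonneg_derivative_imp_mono[OF y _ that]) (use above[OF range] in \<open>auto simp: less_imp_le\<close>)
  have y0: "0 \<le> y 0" and yt: "y t < 1"
    using range[of 0] range[of t] t by auto
  have psi: "continuous_on {y 0..y t} (psi11 f m2 m3)"
    using above y0 yt \<open>0 < m2\<close>
    by (intro continuous_on_psi11 continuous_on_subset[OF f]) auto
  \<comment> \<open>The three terms integrate the three summands of
    \<open>psi11_partial_fraction\<close>.\<close>
  define H where
    "H x = 1 / (m2 * (1 - x)) - m3 / m2\<^sup>2 * ln (1 - x) + integral {y 0..x} (psi11 f m2 m3)" for x
  have H: "(H has_real_derivative 1 / (f x - x)) (at x within {y 0..y t})" if x: "x \<in> {y 0..y t}" for x
  proof -
    have "x < 1" "x < f x"
      using x y0 yt above by auto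
    have "((\<lambda>x. 1 / (m2 * (1 - x))) has_real_derivative 1 / (m2 * (1 - x)\<^sup>2))
        (at x within {y 0..y t})"
      using \<open>x < 1\<close> \<open>0 < m2\<close>
      by (auto intro!: derivative_eq_intros simp: power2_eq_square)
    moreover have "((\<lambda>x. ln (1 - x)) has_real_derivative - 1 / (1 - x)) (at x within {y 0..y t})"
      using \<open>x < 1\<close> by (auto intro!: derivative_eq_intros)
    ultimately have "(H has_real_derivative 1 / (m2 * (1 - x)\<^sup>2)
        - m3 / m2\<^sup>2 * (- 1 / (1 - x)) + psi11 f m2 m3 x) (at x within {y 0..y t})"
      unfolding H_def
      by (intro DERIV_add DERIV_diff DERIV_cmult integral_has_real_derivative[OF psi x])
    then show ?thesis
      using \<open>x < 1\<close> \<open>x < f x\<close> psi11_partial_fraction[of x f m2 m3] \<open>0 < m2\<close> by simp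
  qed
  \<comment> \<open>By the chain rule the speed \<open>f (y v) - y v\<close> cancels the derivative
    of \<open>H\<close>.\<close>
  have "((\<lambda>v. H (y v) - v) has_real_derivative 0) (at v within {0..t})" if v: "v \<in> {0..t}" for v
  proof -
    have "y ` {0..t} \<subseteq> {y 0..y t}" "y v \<in> {y 0..y t}"
      using mono v by auto
    then have "(H \<circ> y has_real_derivative 1 / (f (y v) - y v) * (f (y v) - y v)) (at v within {0..t})"
      by (intro DERIV_image_chain y v DERIV_subset[OF H])
    moreover have "f (y v) - y v \<noteq> 0"
      using above[OF range[OF v]] by simp
    ultimately show ?thesis
      by (auto simp: comp_def intro!: derivative_eq_intros)
  qed
  then obtain c where c: "\<And>v. v \<in> {0..t} \<Longrightarrow> H (y v) - v = c"
    using has_field_derivative_zero_constant[of "{0..t}" "\<lambda>v. H (y v) - v"] by auto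
  have frac: "1 / (m2 * a) - 1 / (m2 * b) = (b - a) / (m2 * b * a)" if "a \<noteq> 0" "b \<noteq> 0" for a b
    using that \<open>0 < m2\<close> by (simp add: divide_simps)
  from c[of 0] c[of t] have "t = H (y t) - H (y 0)"
    using t by simp
  also have "\<dots> = (1 / (m2 * (1 - y t)) - 1 / (m2 * (1 - y 0)))
      - m3 / m2\<^sup>2 * (ln (1 - y t) - ln (1 - y 0)) + integral {y 0..y t} (psi11 f m2 m3)"
    by (simp add: H_def algebra_simps)
  also have "1 / (m2 * (1 - y t)) - 1 / (m2 * (1 - y 0)) = (y t - y 0) / (m2 * (1 - y 0) * (1 - y t))"
    using frac[of "1 - y t" "1 - y 0"] yt mono[of 0 t] t by simp
  also have "ln (1 - y t) - ln (1 - y 0) = ln ((1 - y t) / (1 - y 0))"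
    using yt mono[of 0 t] t by (simp add: ln_div)
  also have "integral {y 0..y t} (psi11 f m2 m3) = (LBINT x=y 0..y t. psi11 f m2 m3 x)"
    using mono[of 0 t] t borel_integrable_atLeastAtMost'[OF psi]
    by (intro interval_integral_eq_integral[symmetric]) auto
  finally show ?thesis .
qed

theorem theorem7:
  fixes M :: "'a measure" and p :: "nat pmf"
    and life :: "nat list \<Rightarrow> 'a \<Rightarrow> real" and offspring :: "nat list \<Rightarrow> 'a \<Rightarrow> nat"
    and f f' f'' f''' :: "real \<Rightarrow> real"
    and F :: "real \<Rightarrow> real \<Rightarrow> real"
    and m2 m3 t s :: real
  assumes "particle_system M p life offspring"
    and "pmf p 1 \<noteq> 1"
    and "f = pgf p"
    and "F = population_pgf M life offspring"
    and "f 1 = 1"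
    and "\<And>x. x \<in> {0..1} \<Longrightarrow> (f has_real_derivative f' x) (at x within {0..1})"
    and "\<And>x. x \<in> {0..1} \<Longrightarrow> (f' has_real_derivative f'' x) (at x within {0..1})"
    and "\<And>x. x \<in> {0..1} \<Longrightarrow> (f'' has_real_derivative f''' x) (at x within {0..1})"
    and "f' 1 = 1"
    and "m2 = f'' 1 / 2"
    and "m3 = f''' 1 / 6"
    and "0 \<le> t"
    and "s \<in> {0..<1}"
  shows "t = (F t s - s) / (m2 * (1 - s) * (1 - F t s))
             - m3 / m2\<^sup>2 * ln ((1 - F t s) / (1 - s))
             + (LBINT x=s..F t s. psi11 f m2 m3 x)"
proof -
  interpret particle_system M p life offspring by fact
  note f = assms(6)[unfolded assms(3)]
  note F_def = assms(4)
  have s: "0 \<le> s" "s < 1" "s \<le> 1"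
    using assms(13) by auto
  have f1: "(pgf p has_real_derivative 1) (at 1 within {0..1})"
    using f[of 1] assms(9) by simp
  obtain k where k: "2 \<le> k" "0 < pmf p k"
    using critical_offspring_ge_2[OF f1 assms(2)] .
  \<comment> \<open>In fact \<open>m2\<close> is at least \<open>pmf p k\<close>.\<close>
  have m2: "0 < m2"
    using second_derivative_pgf_ge[OF f assms(7) assms(9) k(1)] k(2) assms(10) by simp
  have above: "x < pgf p x" if "x \<in> {0..<1}" for x
  proof -
    have "0 < pmf p k * (1 - x)\<^sup>2"
      using k(2) that by simp
    then show ?thesis
      using pgf_ge_quadratic[OF f1 k(1), of x] that by simp
  qed
  have cont: "continuous_on {0..1} (pgf p)"
    using f by (rule DERIV_continuous_on)
  \<comment> \<open>The identity is applied to the trajectory of \<open>F\<close> in time, which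
    starts at \<open>F 0 s = s\<close>.\<close>
  have "t = (F t s - F 0 s) / (m2 * (1 - F 0 s) * (1 - F t s))
      - m3 / m2\<^sup>2 * ln ((1 - F t s) / (1 - F 0 s)) + (LBINT x=F 0 s..F t s. psi11 f m2 m3 x)"
    unfolding assms(3) F_def
  proof (rule autonomous_ode_integral_identity[OF cont above m2 assms(12)])
    show "population_pgf M life offspring v s \<in> {0..<1}" if "v \<in> {0..t}" for v
      using that s population_pgf_bounds population_pgf_less_1 by auto
  qed (use population_pgf_has_derivative[OF cont] s in auto)
  then show ?thesis
    using population_pgf_0 s by (simp add: F_def)
qed

end
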